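(* Let $\alpha,\beta,\delta$ be real numbers with $\alpha,\beta>0$ and let $h_1,h_2\in\mathbb{R}[x,y]$ satisfy $h_i(\rho^\alpha x,\rho^\beta y)=\rho^{\delta}h_i(x,y)$ for $i=1,2$, all $x,y\in\mathbb{R}$ and all real $\rho>0$. Assume that $h_2(x,y)\ge 0$ for all $(x,y)\in\mathbb{R}^2$, and that $h_1(x,y)=h_2(x,y)=0$ if and only if $(x,y)=(0,0)$. Let $\sigma\in\mathbb{C}$ with $\Re\sigma\neq0$, and put $$H=(h_1+i h_2)^{\sigma}(h_1-i h_2)^{\bar\sigma},\qquad V=\tfrac12\,(h_1+i h_2)^{1-\sigma}(h_1-i h_2)^{1-\bar\sigma}.$$ Then the system $$\dot x=H_y\,V,\qquad \dot y=-H_x\,V$$ is a real polynomial $(\alpha,\beta,2\delta-\alpha-\beta)$-weight-homogeneous planar differential system which has a global center (at the origin).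
   Context: A planar system $\dot x=f(x,y)$, $\dot y=g(x,y)$ is $(\alpha,\beta,\omega)$-weight-homogeneous, with $\alpha,\beta>0$ and $\omega\in\mathbb{R}$, if for all $\rho>0$ and $x,y\in\mathbb{R}$ one has $f(\rho^\alpha x,\rho^\beta y)=\rho^{\omega+\alpha}f(x,y)$ and $g(\rho^\alpha x,\rho^\beta y)=\rho^{\omega+\beta}g(x,y)$. The center at the origin is global if $\mathbb{R}^2\setminus\{(0,0)\}$ is a union of periodic orbits. Complex powers: since $h_2\ge0$ and $h_1+ih_2$ vanishes only at the origin, a continuous (single-valued) determination of $\arg(h_1+ih_2)$, and hence of $\log(h_1+ih_2)$, exists on $\mathbb{R}^2\setminus\{(0,0)\}$ (for instance with values of the argument in $[0,\pi]$). Fix such a determination and define $(h_1+ih_2)^{\sigma}$ and $(h_1+ih_2)^{1-\sigma}$ by it, and $(h_1-ih_2)^{\bar\sigma}$, $(h_1-ih_2)^{1-\bar\sigma}$ as their complex conjugates. $H$ and $V$ are then real functions on $\mathbb{R}^2\setminus\{(0,0)\}$. Subscripts $x,y$ denote partial derivatives, and the right-hand sides of the system, initially defined on $\mathbb{R}^2\setminus\{(0,0)\}$, are claimed to be given by real polynomials. *)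

theory Defs
  imports "HOL-Analysis.Analysis" "HOL-Computational_Algebra.Polynomial"
begin

text \<open>
  An element of \<open>\<real>[x,y]\<close> is represented as a polynomial in \<open>y\<close> whose coefficients are
  polynomials in \<open>x\<close>.
\<close>

definition eval2 :: "real poly poly \<Rightarrow> real \<Rightarrow> real \<Rightarrow> real" where
  "eval2 p x y = poly (poly p [:y:]) x"

definition weight_homogeneous ::
    "real \<Rightarrow> real \<Rightarrow> real \<Rightarrow> (real \<Rightarrow> real \<Rightarrow> real) \<Rightarrow> (real \<Rightarrow> real \<Rightarrow> real) \<Rightarrow> bool" where
  "weight_homogeneous \<alpha> \<beta> \<omega> f g \<longleftrightarrow> \<alpha> > 0 \<and> \<beta> > 0 \<and>
     (\<forall>\<rho> x y. \<rho> > 0 \<longrightarrow>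
        f (\<rho> powr \<alpha> * x) (\<rho> powr \<beta> * y) = \<rho> powr (\<omega> + \<alpha>) * f x y \<and>
        g (\<rho> powr \<alpha> * x) (\<rho> powr \<beta> * y) = \<rho> powr (\<omega> + \<beta>) * g x y)"

definition planar_solution ::
    "(real \<Rightarrow> real \<Rightarrow> real) \<Rightarrow> (real \<Rightarrow> real \<Rightarrow> real) \<Rightarrow> (real \<Rightarrow> real \<times> real) \<Rightarrow> bool" where
  "planar_solution f g \<gamma> \<longleftrightarrow>
     (\<forall>t. (\<gamma> has_vector_derivative
            (f (fst (\<gamma> t)) (snd (\<gamma> t)), g (fst (\<gamma> t)) (snd (\<gamma> t)))) (at t))"

text \<open>Equilibria do not count as periodic orbits.\<close>

definition periodic_orbit ::
    "(real \<Rightarrow> real \<Rightarrow> real) \<Rightarrow> (real \<Rightarrow> real \<Rightarrow> real) \<Rightarrow> (real \<times> real) set \<Rightarrow> bool" where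
  "periodic_orbit f g S \<longleftrightarrow>
     (\<exists>\<gamma> T. planar_solution f g \<gamma> \<and> T > 0 \<and> (\<forall>t. \<gamma> (t + T) = \<gamma> t) \<and>
            (\<exists>t. \<gamma> t \<noteq> \<gamma> 0) \<and> S = range \<gamma>)"

definition union_of_periodic_orbits ::
    "(real \<Rightarrow> real \<Rightarrow> real) \<Rightarrow> (real \<Rightarrow> real \<Rightarrow> real) \<Rightarrow> (real \<times> real) set \<Rightarrow> bool" where
  "union_of_periodic_orbits f g A \<longleftrightarrow> (\<exists>\<S>. (\<forall>S\<in>\<S>. periodic_orbit f g S) \<and> A = \<Union>\<S>)"

definition center_at_origin ::
    "(real \<Rightarrow> real \<Rightarrow> real) \<Rightarrow> (real \<Rightarrow> real \<Rightarrow> real) \<Rightarrow> bool" where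
  "center_at_origin f g \<longleftrightarrow> f 0 0 = 0 \<and> g 0 0 = 0 \<and>
     (\<exists>U. open U \<and> (0, 0) \<in> U \<and> union_of_periodic_orbits f g (U - {(0, 0)}))"

definition global_center ::
    "(real \<Rightarrow> real \<Rightarrow> real) \<Rightarrow> (real \<Rightarrow> real \<Rightarrow> real) \<Rightarrow> bool" where
  "global_center f g \<longleftrightarrow>
     center_at_origin f g \<and> union_of_periodic_orbits f g (UNIV - {(0, 0)})"

definition partial_x :: "(real \<Rightarrow> real \<Rightarrow> complex) \<Rightarrow> real \<Rightarrow> real \<Rightarrow> complex" where
  "partial_x F x y = vector_derivative (\<lambda>s. F s y) (at x)"

definition partial_y :: "(real \<Rightarrow> real \<Rightarrow> complex) \<Rightarrow> real \<Rightarrow> real \<Rightarrow> complex" where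
  "partial_y F x y = vector_derivative (\<lambda>s. F x s) (at y)"

definition partials_exist_at :: "(real \<Rightarrow> real \<Rightarrow> complex) \<Rightarrow> real \<Rightarrow> real \<Rightarrow> bool" where
  "partials_exist_at F x y \<longleftrightarrow>
     (\<lambda>s. F s y) differentiable (at x) \<and> (\<lambda>s. F x s) differentiable (at y)"

definition hc :: "real poly poly \<Rightarrow> real poly poly \<Rightarrow> real \<Rightarrow> real \<Rightarrow> complex" where
  "hc h1 h2 x y = Complex (eval2 h1 x y) (eval2 h2 x y)"

definition arg_determination :: "(real \<Rightarrow> real \<Rightarrow> complex) \<Rightarrow> (real \<times> real \<Rightarrow> real) \<Rightarrow> bool" where
  "arg_determination h \<theta> \<longleftrightarrow>
     continuous_on (UNIV - {(0, 0)}) \<theta> \<and>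
     (\<forall>x y. (x, y) \<noteq> (0, 0) \<longrightarrow> h x y = of_real (cmod (h x y)) * cis (\<theta> (x, y)))"

text \<open>
  The power \<open>h\<^sup>s = exp (s log h)\<close>, where \<open>log h = ln \<bar>h\<bar> + i \<theta>\<close>. The library's \<open>powr\<close> on
  complex numbers is not used here because it is tied to the principal logarithm.
\<close>

definition cpow ::
    "(real \<Rightarrow> real \<Rightarrow> complex) \<Rightarrow> (real \<times> real \<Rightarrow> real) \<Rightarrow> complex \<Rightarrow> real \<Rightarrow> real \<Rightarrow> complex" where
  "cpow h \<theta> s x y = exp (s * Complex (ln (cmod (h x y))) (\<theta> (x, y)))"

text \<open>
  The factors with base \<open>h1 - i h2\<close> and conjugated exponent are by convention the conjugates
  of those with base \<open>h1 + i h2\<close>.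
\<close>

definition Hfun ::
    "(real \<Rightarrow> real \<Rightarrow> complex) \<Rightarrow> (real \<times> real \<Rightarrow> real) \<Rightarrow> complex \<Rightarrow> real \<Rightarrow> real \<Rightarrow> complex" where
  "Hfun h \<theta> \<sigma> x y = cpow h \<theta> \<sigma> x y * cnj (cpow h \<theta> \<sigma> x y)"

definition Vfun ::
    "(real \<Rightarrow> real \<Rightarrow> complex) \<Rightarrow> (real \<times> real \<Rightarrow> real) \<Rightarrow> complex \<Rightarrow> real \<Rightarrow> real \<Rightarrow> complex" where
  "Vfun h \<theta> \<sigma> x y = 1 / 2 * (cpow h \<theta> (1 - \<sigma>) x y * cnj (cpow h \<theta> (1 - \<sigma>) x y))"

lemma continuous_on_eval2: "continuous_on A (\<lambda>z. eval2 p (fst z) (snd z))"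
proof -
  have *: "continuous_on A (\<lambda>z. poly q (fst z))" for q :: "real poly"
    by (intro continuous_intros)
  show ?thesis
    unfolding eval2_def
    by (induction p) (auto intro!: continuous_intros *)
qed

text \<open>Continuous determinations of the argument exist under the hypotheses considered.\<close>

lemma arg_determination_exists:
  assumes nonneg: "\<And>x y. eval2 h2 x y \<ge> 0"
    and zero: "\<And>x y. eval2 h1 x y = 0 \<and> eval2 h2 x y = 0 \<longleftrightarrow> x = 0 \<and> y = 0"
  shows "\<exists>\<theta>. arg_determination (hc h1 h2) \<theta>"
proof -
  define k where "k z = - \<i> * hc h1 h2 (fst z) (snd z)" for z
  define \<theta> where "\<theta> z = Arg (k z) + pi / 2" for z
  have cont: "continuous_on A k" for A
    unfolding k_def hc_def Complex_eq
    by (intro continuous_intros continuous_on_eval2)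
  have nz: "k z \<notin> \<real>\<^sub>\<le>\<^sub>0" if "z \<noteq> (0, 0)" for z
  proof
    assume "k z \<in> \<real>\<^sub>\<le>\<^sub>0"
    hence "eval2 h2 (fst z) (snd z) \<le> 0" "eval2 h1 (fst z) (snd z) = 0"
      by (auto simp: k_def hc_def complex_nonpos_Reals_iff)
    with nonneg[of "fst z" "snd z"] zero[of "fst z" "snd z"] that show False
      by (cases z) auto
  qed
  have "continuous_on (UNIV - {(0, 0)}) \<theta>"
    unfolding \<theta>_def using nz
    by (intro continuous_intros continuous_on_Arg' cont) auto
  moreover have "hc h1 h2 x y = of_real (cmod (hc h1 h2 x y)) * cis (\<theta> (x, y))"
    if "(x, y) \<noteq> (0, 0)" for x y
  proof -
    have "k (x, y) = of_real (cmod (k (x, y))) * cis (Arg (k (x, y)))"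
      by (metis rcis_cmod_Arg rcis_def)
    moreover have "cmod (k (x, y)) = cmod (hc h1 h2 x y)"
      by (simp add: k_def norm_mult)
    moreover have "hc h1 h2 x y = k (x, y) * \<i>"
      by (simp add: k_def complex_eq_iff)
    moreover have "cis (\<theta> (x, y)) = cis (Arg (k (x, y))) * \<i>"
      by (simp add: \<theta>_def flip: cis_mult)
    ultimately show ?thesis
      by (simp add: mult.assoc)
  qed
  ultimately show ?thesis
    unfolding arg_determination_def by blast
qed

end

theory Submission
  imports Defs
begin

text \<open>
  Let \<open>W = ln \<bar>h\<bar> + i \<theta>\<close> and \<open>L = Re (\<sigma> W)\<close>, so that \<open>H = exp (2 L)\<close> and \<open>2 H V = \<bar>h\<bar>\<^sup>2\<close>. Since
  \<open>dW = dh / h\<close>, the field is \<open>\<bar>h\<bar>\<^sup>2 (L\<^sub>y, - L\<^sub>x) = (Re (\<sigma> h\<^sub>y cnj h), - Re (\<sigma> h\<^sub>x cnj h))\<close>, which is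
  polynomial. Along the weighted flow \<open>(e\<^sup>\<alpha>\<^sup>s x, e\<^sup>\<beta>\<^sup>s y)\<close> the function \<open>L\<close> grows linearly with slope
  \<open>\<delta> Re \<sigma> \<noteq> 0\<close>, so each point of a Euclidean circle can be pushed along this flow onto a given
  level curve of \<open>L\<close>. This yields a closed regular parametrization of that curve, and its tangent
  is a nonzero multiple of the field. The inverse of a primitive of the multiplier turns it into
  a periodic solution, so no existence theorem for differential equations is needed.
\<close>

section \<open>Derivative of a continuous logarithm\<close>

text \<open>Continuity keeps \<open>W w - W z\<close> in the strip of imaginary parts below
  \<open>pi\<close> in modulus for \<open>w\<close> near \<open>z\<close>, and there the principal
  \<open>Ln\<close> inverts \<open>exp\<close>. So locally
  \<open>W w = W z + Ln (h w / h z)\<close>, and only the derivative of \<open>Ln\<close> at 1 is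
  needed. The domain is general because the rule serves both on the plane and along a real
  parameter.\<close>

lemma has_derivative_continuous_log:
  fixes W h :: "'a::real_normed_vector \<Rightarrow> complex"
  assumes "isCont W z" and ev: "eventually (\<lambda>w. exp (W w) = h w) (nhds z)"
    and h: "(h has_derivative h') (at z)"
  shows "(W has_derivative (\<lambda>v. h' v / h z)) (at z)"
proof -
  have hz: "h z = exp (W z)"
    using eventually_nhds_x_imp_x[OF ev] by simp
  hence nz: "h z \<noteq> 0" by simp
  have Ln: "(Ln has_derivative (*) 1) (at (h z / h z))"
    using has_field_derivative_Ln[of "h z / h z"] nz
    by (simp add: has_field_derivative_def)
  have "((\<lambda>w. h w / h z) has_derivative (\<lambda>v. h' v / h z)) (at z)"
    by (rule bounded_linear.has_derivative[OF bounded_linear_divide h])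
  from has_derivative_compose[where f="\<lambda>w. h w / h z" and g=Ln and g'="(*) 1", OF this Ln]
  have D: "((\<lambda>w. W z + Ln (h w / h z)) has_derivative (\<lambda>v. h' v / h z)) (at z)"
    using has_derivative_add[OF has_derivative_const] by fastforce
  have "eventually (\<lambda>w. dist (W w) (W z) < pi) (at z)"
    using assms(1) pi_gt_zero unfolding isCont_def by (rule tendstoD)
  moreover have "eventually (\<lambda>w. exp (W w) = h w) (at z)"
    using ev by (auto simp: eventually_at_filter elim: eventually_mono)
  ultimately have "eventually (\<lambda>w. W z + Ln (h w / h z) = W w) (at z)"
  proof eventually_elim
    case (elim w)
    have "\<bar>Im (W w - W z)\<bar> < pi"
      using elim(1) abs_Im_le_cmod[of "W w - W z"] by (simp add: dist_norm)
    hence "Ln (exp (W w - W z)) = W w - W z"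
      by (intro Ln_exp) (auto simp: abs_less_iff)
    thus ?case
      using elim(2) by (simp add: exp_diff hz)
  qed
  from has_derivative_transform_eventually[OF D this] show ?thesis
    using nz by (simp add: hz)
qed

section \<open>Differential calculus of bivariate polynomials\<close>

lemma eval2_pCons: "eval2 (pCons a p) x y = poly a x + y * eval2 p x y"
  by (simp add: eval2_def)

lemma eval2_simps [simp]:
  "eval2 0 x y = 0"
  "eval2 (p + q) x y = eval2 p x y + eval2 q x y"
  "eval2 (p - q) x y = eval2 p x y - eval2 q x y"
  "eval2 (p * q) x y = eval2 p x y * eval2 q x y"
  "eval2 (smult [:c:] p) x y = c * eval2 p x y"
  by (simp_all add: eval2_def)

text \<open>Coefficients are polynomials in \<open>x\<close>, so \<open>map_poly pderiv\<close>
  differentiates in \<open>x\<close> and the outer \<open>pderiv\<close> in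
  \<open>y\<close>.\<close>

lemma has_derivative_eval2:
  "((\<lambda>z. eval2 p (fst z) (snd z)) has_derivative
     (\<lambda>v. eval2 (map_poly pderiv p) x y * fst v + eval2 (pderiv p) x y * snd v)) (at (x, y))"
proof (induction p)
  case 0
  show ?case by simp
next
  case (pCons a p)
  have a: "((\<lambda>z. poly a (fst z)) has_derivative (\<lambda>v. poly (pderiv a) x * fst v)) (at (x, y))"
    using has_derivative_compose[of fst fst "(x, y)" UNIV "poly a" "(*) (poly (pderiv a) x)"]
      poly_DERIV[of a x]
    by (simp add: has_field_derivative_def has_derivative_fst bounded_linear_imp_has_derivative bounded_linear_fst)
  have "((\<lambda>z. poly a (fst z) + snd z * eval2 p (fst z) (snd z)) has_derivative
     (\<lambda>v. poly (pderiv a) x * fst v + (snd (x, y) * (eval2 (map_poly pderiv p) x y * fst v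
        + eval2 (pderiv p) x y * snd v) + snd v * eval2 p (fst (x, y)) (snd (x, y))))) (at (x, y))"
    by (intro has_derivative_add has_derivative_mult a pCons.IH has_derivative_snd has_derivative_ident)
  thus ?case
    by (simp add: eval2_pCons pderiv_pCons map_poly_pCons algebra_simps)
qed

text \<open>Besides genuine curves, this covers partial derivatives, by freezing one
  coordinate.\<close>

lemma has_derivative_pair_curve:
  fixes F :: "real \<times> real \<Rightarrow> 'b::real_normed_vector"
  assumes "(F has_derivative F') (at (x t, y t))"
    and "(x has_real_derivative x') (at t)" and "(y has_real_derivative y') (at t)"
  shows "((\<lambda>s. F (x s, y s)) has_vector_derivative F' (x', y')) (at t)"
proof -
  have "((\<lambda>s. (x s, y s)) has_vector_derivative (x', y')) (at t)"
    using assms(2,3)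
    by (intro has_vector_derivative_Pair) (simp_all add: has_real_derivative_iff_has_vector_derivative)
  thus ?thesis
    using vector_derivative_diff_chain_within[of "\<lambda>s. (x s, y s)" _ t UNIV F F'] assms(1)
    by (simp add: o_def has_derivative_at_withinI)
qed

lemma eval2_partials:
  "((\<lambda>s. eval2 p s y) has_real_derivative eval2 (map_poly pderiv p) x y) (at x)"
  "((\<lambda>s. eval2 p x s) has_real_derivative eval2 (pderiv p) x y) (at y)"
  using has_derivative_pair_curve[where x="\<lambda>s. s" and y="\<lambda>_. y" and t=x and x'=1 and y'=0,
      OF has_derivative_eval2[of p x y]]
    has_derivative_pair_curve[where x="\<lambda>_. x" and y="\<lambda>s. s" and t=y and x'=0 and y'=1,
      OF has_derivative_eval2[of p x y]]
  by (simp_all add: has_real_derivative_iff_has_vector_derivative)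

text \<open>Both sides of \<open>hom\<close> are differentiated in one variable and compared by
  uniqueness of derivatives. The chain-rule factor stays on the left, so \<open>A\<close> and
  \<open>B\<close> may be arbitrary.\<close>

lemma eval2_partials_homogeneous:
  assumes hom: "\<And>x y. eval2 p (A * x) (B * y) = C * eval2 p x y"
  shows "A * eval2 (map_poly pderiv p) (A * x) (B * y) = C * eval2 (map_poly pderiv p) x y"
    and "B * eval2 (pderiv p) (A * x) (B * y) = C * eval2 (pderiv p) x y"
proof -
  have D1: "((\<lambda>s. eval2 p (A * s) (B * y)) has_real_derivative
          eval2 (map_poly pderiv p) (A * x) (B * y) * A) (at x)"
    by (intro DERIV_chain2[OF eval2_partials(1)]) (auto intro!: derivative_eq_intros)
  have D2: "((\<lambda>s. C * eval2 p s y) has_real_derivative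
          C * eval2 (map_poly pderiv p) x y) (at x)"
    by (intro DERIV_cmult eval2_partials(1))
  show "A * eval2 (map_poly pderiv p) (A * x) (B * y) = C * eval2 (map_poly pderiv p) x y"
    using DERIV_unique[OF D1[unfolded hom] D2] by (simp add: mult.commute)
next
  have D1: "((\<lambda>s. eval2 p (A * x) (B * s)) has_real_derivative
          eval2 (pderiv p) (A * x) (B * y) * B) (at y)"
    by (intro DERIV_chain2[OF eval2_partials(2)]) (auto intro!: derivative_eq_intros)
  have D2: "((\<lambda>s. C * eval2 p x s) has_real_derivative
          C * eval2 (pderiv p) x y) (at y)"
    by (intro DERIV_cmult eval2_partials(2))
  show "B * eval2 (pderiv p) (A * x) (B * y) = C * eval2 (pderiv p) x y"
    using DERIV_unique[OF D1[unfolded hom] D2] by (simp add: mult.commute)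
qed

section \<open>Time changes and periodic orbits\<close>

text \<open>\<open>\<psi>\<close> is the inverse of the primitive \<open>G\<close> of
  \<open>l\<close> with \<open>G 0 = 0\<close>. Periodicity of \<open>l\<close> gives
  \<open>G (u + p) = G u + T\<close> with \<open>T = G p\<close>; this supplies the period and makes
  \<open>G\<close> unbounded in both directions, hence onto.\<close>

lemma periodic_time_change:
  fixes l :: "real \<Rightarrow> real"
  assumes cont: "continuous_on UNIV l" and pos: "\<And>u. l u > 0"
    and "p > 0" and per: "\<And>u. l (u + p) = l u"
  obtains \<psi> T where "T > 0" "\<psi> 0 = 0" "surj \<psi>"
    "\<And>t. (\<psi> has_real_derivative 1 / l (\<psi> t)) (at t)" "\<And>t. \<psi> (t + T) = \<psi> t + p"
proof -
  obtain F where "\<And>u. (F has_vector_derivative l u) (at u)"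
    using einterval_antiderivative[of "-\<infinity>" "\<infinity>" l] cont
    by (auto simp: continuous_on_eq_continuous_at)
  define G where "G u = F u - F 0" for u
  have G: "(G has_real_derivative l u) (at u)" for u
    unfolding G_def using \<open>(F has_vector_derivative l u) (at u)\<close>
    by (auto simp: has_real_derivative_iff_has_vector_derivative intro!: derivative_eq_intros)
  have mono: "strict_mono G"
    by (rule strict_monoI) (meson DERIV_pos_imp_increasing G pos)
  have contG: "continuous_on A G" for A
    using G by (meson DERIV_isCont continuous_at_imp_continuous_on)
  define T where "T = G p"
  have Gp: "G (u + p) = G u + T" for u
  proof -
    have D: "((\<lambda>u. G (u + p) - G u) has_real_derivative 0) (at u)" for u
      using DERIV_shift[of G "l (u + p)" u p] G[of "u + p"] G[of u] per[of u]
      by (auto intro!: derivative_eq_intros)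
    have "G (u + p) - G u = G (0 + p) - G 0"
      using DERIV_isconst_all[of "\<lambda>u. G (u + p) - G u" u 0] D by blast
    thus ?thesis by (simp add: T_def G_def)
  qed
  have T: "T > 0"
    using strict_monoD[OF mono \<open>p > 0\<close>] by (simp add: T_def G_def)
  \<comment> \<open>The values at multiples of \<open>p\<close> bracket any given real, as the
    intermediate value theorem requires.\<close>
  have shift: "G (of_nat n * p) = of_nat n * T" "G (- (of_nat n * p)) = - (of_nat n * T)" for n
  proof (induction n)
    case (Suc n)
    {
      case 1
      thus ?case using Gp[of "of_nat n * p"] Suc by (simp add: algebra_simps)
    next
      case 2
      thus ?case using Gp[of "- (of_nat (Suc n) * p)"] Suc by (simp add: algebra_simps)
    }
  qed (simp_all add: G_def)
  have "\<exists>u. G u = t" for t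
  proof -
    obtain n :: nat where "\<bar>t\<bar> < of_nat n * T"
      using reals_Archimedean3[OF T] by blast
    hence "G (- (of_nat n * p)) \<le> t" "t \<le> G (of_nat n * p)"
      by (simp_all add: shift)
    from IVT'[OF this _ contG] \<open>p > 0\<close> show ?thesis by auto
  qed
  hence surj: "surj G" by (metis surjI surj_def)
  define \<psi> where "\<psi> = inv G"
  have inj: "inj G" using mono by (rule strict_mono_imp_inj_on)
  have \<psi>G [simp]: "\<psi> (G u) = u" "G (\<psi> t) = t" for u t
    unfolding \<psi>_def using inj surj by (simp_all add: surj_f_inv_f)
  have "isCont \<psi> (G u)" for u
    by (rule isCont_inverse_function[of 1]) (auto intro: DERIV_isCont G)
  hence cont\<psi>: "isCont \<psi> t" for t by (metis \<psi>G(2))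
  have "(\<psi> has_real_derivative inverse (l (\<psi> t))) (at t)" for t
    by (rule DERIV_inverse_function[where f=G and a="t - 1" and b="t + 1"])
       (use pos[of "\<psi> t"] in \<open>auto intro: G cont\<psi>\<close>)
  moreover have "\<psi> (t + T) = \<psi> t + p" for t
    by (metis Gp \<psi>G)
  moreover have "\<psi> 0 = 0" using \<psi>G(1)[of 0] by (simp add: G_def)
  moreover have "surj \<psi>" by (metis \<psi>G(1) surjI)
  ultimately show thesis using that T by (simp add: inverse_eq_divide)
qed

text \<open>The speed \<open>1 / l\<close> of the time change cancels the multiplier
  \<open>l\<close>, and its surjectivity preserves the range. The hypothesis
  \<open>z a \<noteq> z 0\<close> rules out an equilibrium.\<close>

lemma periodic_orbit_range_closed_curve:
  fixes z :: "real \<Rightarrow> real \<times> real"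
  assumes "continuous_on UNIV l" and pos: "\<And>u. l u > 0"
    and "p > 0" and "\<And>u. l (u + p) = l u" and per: "\<And>u. z (u + p) = z u"
    and z: "\<And>u. (z has_vector_derivative
          l u *\<^sub>R (f (fst (z u)) (snd (z u)), g (fst (z u)) (snd (z u)))) (at u)"
    and "z a \<noteq> z 0"
  shows "periodic_orbit f g (range z)"
proof -
  obtain \<psi> T where \<psi>: "T > 0" "\<psi> 0 = 0" "surj \<psi>"
    "\<And>t. (\<psi> has_real_derivative 1 / l (\<psi> t)) (at t)" "\<And>t. \<psi> (t + T) = \<psi> t + p"
    by (rule periodic_time_change[OF assms(1-4)]) (rule that)
  have "planar_solution f g (z \<circ> \<psi>)"
    unfolding planar_solution_def
  proof
    fix t
    have "(z \<circ> \<psi> has_vector_derivative (1 / l (\<psi> t)) *\<^sub>R l (\<psi> t) *\<^sub>R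
            (f (fst (z (\<psi> t))) (snd (z (\<psi> t))), g (fst (z (\<psi> t))) (snd (z (\<psi> t))))) (at t)"
      using \<psi>(4) z
      by (intro vector_diff_chain_at) (auto simp: has_real_derivative_iff_has_vector_derivative)
    thus "(z \<circ> \<psi> has_vector_derivative
        (f (fst ((z \<circ> \<psi>) t)) (snd ((z \<circ> \<psi>) t)), g (fst ((z \<circ> \<psi>) t)) (snd ((z \<circ> \<psi>) t)))) (at t)"
      using pos[of "\<psi> t"] by simp
  qed
  moreover have "range z = range (z \<circ> \<psi>)"
    using \<psi>(3) by (metis image_comp)
  moreover have "\<exists>t. (z \<circ> \<psi>) t \<noteq> (z \<circ> \<psi>) 0"
    using assms(7) \<psi>(2,3) by (metis comp_apply surj_f_inv_f)
  ultimately show ?thesis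
    unfolding periodic_orbit_def using \<psi>(1,5) per
    by (intro exI[of _ "z \<circ> \<psi>"] exI[of _ T]) auto
qed

lemma union_of_periodic_orbitsI:
  assumes "\<And>z. z \<in> A \<Longrightarrow> \<exists>S. periodic_orbit f g S \<and> z \<in> S \<and> S \<subseteq> A"
  shows "union_of_periodic_orbits f g A"
  unfolding union_of_periodic_orbits_def
  by (rule exI[of _ "{S. periodic_orbit f g S \<and> S \<subseteq> A}"]) (use assms in blast)

section \<open>Level curves of weight-logarithmic functions\<close>

text \<open>The tangent of the level curve satisfies two linear equations: it is orthogonal to the
  gradient \<open>(p, q)\<close>, and its cross product with the weighted Euler field
  \<open>(\<alpha> x, \<beta> y)\<close> is known and nonzero. With Euler's identity these force it,
  for the right orientation, to be a positive multiple of \<open>(q, - p)\<close> and hence of the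
  field.\<close>

lemma weighted_polar_union_of_periodic_orbits:
  fixes L m :: "real \<times> real \<Rightarrow> real" and p q f g :: "real \<Rightarrow> real \<Rightarrow> real"
  assumes "\<alpha> > 0" "\<beta> > 0" "\<kappa> \<noteq> 0"
    and LD: "\<And>x y. (x, y) \<noteq> (0, 0) \<Longrightarrow>
      (L has_derivative (\<lambda>v. p x y * fst v + q x y * snd v)) (at (x, y))"
    and Lhom: "\<And>x y s. (x, y) \<noteq> (0, 0) \<Longrightarrow>
      L (exp (\<alpha> * s) * x, exp (\<beta> * s) * y) = L (x, y) + \<kappa> * s"
    and m: "continuous_on (UNIV - {(0, 0)}) m" "\<And>z. z \<noteq> (0, 0) \<Longrightarrow> m z > 0"
    and f: "\<And>x y. (x, y) \<noteq> (0, 0) \<Longrightarrow> f x y = m (x, y) * q x y"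
    and g: "\<And>x y. (x, y) \<noteq> (0, 0) \<Longrightarrow> g x y = - (m (x, y) * p x y)"
  shows "union_of_periodic_orbits f g (UNIV - {(0, 0)})"
proof (rule union_of_periodic_orbitsI)
  \<comment> \<open>Euler's identity for \<open>L\<close>, obtained by differentiating
    \<open>Lhom\<close> at \<open>s = 0\<close>.\<close>
  have euler: "\<alpha> * x * p x y + \<beta> * y * q x y = \<kappa>" if "(x, y) \<noteq> (0, 0)" for x y
  proof -
    have "((\<lambda>s. L (exp (\<alpha> * s) * x, exp (\<beta> * s) * y)) has_vector_derivative
        p x y * fst (\<alpha> * x, \<beta> * y) + q x y * snd (\<alpha> * x, \<beta> * y)) (at 0)"
      using LD[OF that]
      by (intro has_derivative_pair_curve) (auto intro!: derivative_eq_intros)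
    hence "((\<lambda>s. L (x, y) + \<kappa> * s) has_real_derivative p x y * (\<alpha> * x) + q x y * (\<beta> * y)) (at 0)"
      by (simp add: Lhom[OF that] has_real_derivative_iff_has_vector_derivative)
    moreover have "((\<lambda>s. L (x, y) + \<kappa> * s) has_real_derivative \<kappa>) (at 0)"
      by (auto intro!: derivative_eq_intros)
    ultimately show ?thesis
      using DERIV_unique by (fastforce simp: algebra_simps)
  qed
  fix z0 :: "real \<times> real"
  assume "z0 \<in> UNIV - {(0, 0)}"
  then obtain x0 y0 where z0: "z0 = (x0, y0)" "(x0, y0) \<noteq> (0, 0)"
    by (cases z0) auto
  \<comment> \<open>The circle passes through \<open>z0\<close>, where \<open>S = 0\<close>; hence the level curve does too. The sign
    \<open>\<epsilon>\<close> orients the curve along the field.\<close>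
  define R where "R = sqrt (x0\<^sup>2 + y0\<^sup>2)"
  have R: "R > 0" "R\<^sup>2 = x0\<^sup>2 + y0\<^sup>2"
    using z0(2) by (auto simp: R_def sum_power2_gt_zero_iff)
  define \<epsilon> where "\<epsilon> = - sgn \<kappa>"
  have \<epsilon>: "\<epsilon> * \<epsilon> = 1" "\<bar>\<kappa>\<bar> = - (\<epsilon> * \<kappa>)"
    using \<open>\<kappa> \<noteq> 0\<close> by (auto simp: \<epsilon>_def sgn_if)
  define C where "C u = R * cos u" for u
  define D where "D u = R * (\<epsilon> * sin u)" for u
  have CD: "(C u, D u) \<noteq> (0, 0)" for u
    using R(1) \<epsilon>(1) sin_zero_abs_cos_one[of u] by (auto simp: C_def D_def)
  define S where "S u = (L (x0, y0) - L (C u, D u)) / \<kappa>" for u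
  define X where "X u = exp (\<alpha> * S u) * C u" for u
  define Y where "Y u = exp (\<beta> * S u) * D u" for u
  have XY: "(X u, Y u) \<noteq> (0, 0)" for u
    using CD[of u] by (auto simp: X_def Y_def)
  define C' where "C' u = - (R * sin u)" for u
  define D' where "D' u = R * (\<epsilon> * cos u)" for u
  have C': "(C has_real_derivative C' u) (at u)" for u
    unfolding C_def C'_def by (auto intro!: derivative_eq_intros)
  have D': "(D has_real_derivative D' u) (at u)" for u
    unfolding D_def D'_def by (auto intro!: derivative_eq_intros)
  define S' where "S' u = - (p (C u) (D u) * C' u + q (C u) (D u) * D' u) / \<kappa>" for u
  have S': "(S has_real_derivative S' u) (at u)" for u
  proof -
    have "((\<lambda>u. L (C u, D u)) has_real_derivative p (C u) (D u) * C' u + q (C u) (D u) * D' u) (at u)"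
      using has_derivative_pair_curve[OF LD[OF CD] C' D']
      by (simp add: has_real_derivative_iff_has_vector_derivative)
    thus ?thesis
      unfolding S_def S'_def using \<open>\<kappa> \<noteq> 0\<close> by (auto intro!: derivative_eq_intros)
  qed
  define X' where "X' u = exp (\<alpha> * S u) * (\<alpha> * S' u * C u + C' u)" for u
  define Y' where "Y' u = exp (\<beta> * S u) * (\<beta> * S' u * D u + D' u)" for u
  have X': "(X has_real_derivative X' u) (at u)" for u
    unfolding X_def X'_def by (auto intro!: derivative_eq_intros S' C' simp: algebra_simps)
  have Y': "(Y has_real_derivative Y' u) (at u)" for u
    unfolding Y_def Y'_def by (auto intro!: derivative_eq_intros S' D' simp: algebra_simps)
  \<comment> \<open>Up to the sign \<open>\<epsilon>\<close>, this is the cross product of the Euler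
    field with the tangent. The \<open>S'\<close> terms of the tangent are parallel to the Euler
    field and drop out, leaving only the contribution of the circle.\<close>
  define E where "E u = exp ((\<alpha> + \<beta>) * S u) * R\<^sup>2 * (\<alpha> * (cos u)\<^sup>2 + \<beta> * (sin u)\<^sup>2)" for u
  have E: "E u > 0" for u
  proof -
    have "\<alpha> * (cos u)\<^sup>2 + \<beta> * (sin u)\<^sup>2 \<ge> min \<alpha> \<beta> * (cos u)\<^sup>2 + min \<alpha> \<beta> * (sin u)\<^sup>2"
      by (intro add_mono mult_right_mono) auto
    also have "min \<alpha> \<beta> * (cos u)\<^sup>2 + min \<alpha> \<beta> * (sin u)\<^sup>2 = min \<alpha> \<beta>"
      by (simp flip: distrib_left)
    finally show ?thesis
      using \<open>\<alpha> > 0\<close> \<open>\<beta> > 0\<close> R(1) by (simp add: E_def)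
  qed
  have cross: "\<alpha> * X u * Y' u - \<beta> * Y u * X' u = \<epsilon> * E u" for u
  proof -
    have "\<alpha> * X u * Y' u - \<beta> * Y u * X' u
        = exp (\<alpha> * S u) * exp (\<beta> * S u) * (\<alpha> * C u * D' u - \<beta> * D u * C' u)"
      by (simp add: X_def Y_def X'_def Y'_def algebra_simps)
    also have "\<dots> = \<epsilon> * E u"
      by (simp add: E_def C_def D_def C'_def D'_def distrib_right exp_add power2_eq_square algebra_simps)
    finally show ?thesis .
  qed
  have level: "p (X u) (Y u) * X' u + q (X u) (Y u) * Y' u = 0" for u
  proof -
    have "L (X u, Y u) = L (x0, y0)" for u
      using Lhom[OF CD[of u], of "S u"] \<open>\<kappa> \<noteq> 0\<close> by (simp add: X_def Y_def S_def)
    moreover have "((\<lambda>u. L (X u, Y u)) has_real_derivative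
        p (X u) (Y u) * X' u + q (X u) (Y u) * Y' u) (at u)"
      using has_derivative_pair_curve[OF LD[OF XY] X' Y']
      by (simp add: has_real_derivative_iff_has_vector_derivative)
    ultimately show ?thesis
      using DERIV_unique[OF _ DERIV_const[of "L (x0, y0)" "at u"]] by simp
  qed
  \<comment> \<open>The multiplier is read off from \<open>\<bar>\<kappa>\<bar> * X' = q * E\<close>
    and \<open>f = m * q\<close>.\<close>
  define l where "l u = E u / (\<bar>\<kappa>\<bar> * m (X u, Y u))" for u
  have field: "X' u = l u * f (X u) (Y u)" "Y' u = l u * g (X u) (Y u)" for u
  proof -
    have mpos: "m (X u, Y u) > 0" using m(2)[OF XY] .
    let ?p = "p (X u) (Y u)" and ?q = "q (X u) (Y u)"
    \<comment> \<open>Euler's identity expands \<open>\<kappa>\<close>, and trading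
      \<open>?p * X'\<close> for \<open>- ?q * Y'\<close> by \<open>level\<close> leaves
      \<open>- ?q\<close> times the cross product. Multiplication by \<open>- \<epsilon>\<close>
      then turns \<open>\<kappa>\<close> into \<open>\<bar>\<kappa>\<bar>\<close>.\<close>
    have "\<kappa> * X' u = \<alpha> * X u * (?p * X' u) + \<beta> * Y u * ?q * X' u"
      by (subst euler[OF XY, of u, symmetric]) (simp add: algebra_simps)
    also have "?p * X' u = - (?q * Y' u)" using level[of u] by simp
    finally have "\<kappa> * X' u = - ?q * (\<epsilon> * E u)"
      unfolding cross[of u, symmetric] by (simp add: algebra_simps)
    hence "- \<epsilon> * (\<kappa> * X' u) = (\<epsilon> * \<epsilon>) * (?q * E u)" by simp
    hence "\<bar>\<kappa>\<bar> * X' u = ?q * E u" by (simp add: \<epsilon>)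
    thus "X' u = l u * f (X u) (Y u)"
      using mpos \<open>\<kappa> \<noteq> 0\<close> by (simp add: l_def f[OF XY] field_simps)
    have "\<kappa> * Y' u = \<alpha> * X u * ?p * Y' u + \<beta> * Y u * (?q * Y' u)"
      by (subst euler[OF XY, of u, symmetric]) (simp add: algebra_simps)
    also have "?q * Y' u = - (?p * X' u)" using level[of u] by simp
    finally have "\<kappa> * Y' u = ?p * (\<epsilon> * E u)"
      unfolding cross[of u, symmetric] by (simp add: algebra_simps)
    hence "- \<epsilon> * (\<kappa> * Y' u) = (\<epsilon> * \<epsilon>) * (- ?p * E u)" by simp
    hence "\<bar>\<kappa>\<bar> * Y' u = - ?p * E u" by (simp add: \<epsilon>)
    thus "Y' u = l u * g (X u) (Y u)"
      using mpos \<open>\<kappa> \<noteq> 0\<close> by (simp add: l_def g[OF XY] field_simps)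
  qed
  define z where "z u = (X u, Y u)" for u
  have z: "(z has_vector_derivative
      l u *\<^sub>R (f (fst (z u)) (snd (z u)), g (fst (z u)) (snd (z u)))) (at u)" for u
    unfolding z_def using X'[of u] Y'[of u]
    by (auto simp: field has_real_derivative_iff_has_vector_derivative intro!: has_vector_derivative_Pair)
  have per: "C (u + 2 * pi) = C u" "D (u + 2 * pi) = D u" for u
    by (simp_all add: C_def D_def)
  have perz: "z (u + 2 * pi) = z u" and perl: "l (u + 2 * pi) = l u" for u
    by (simp_all add: z_def l_def E_def X_def Y_def S_def per)
  have contz: "continuous_on UNIV z"
    using z by (meson continuous_at_imp_continuous_on has_vector_derivative_continuous)
  have contS: "continuous_on UNIV S"
    using S' by (meson DERIV_isCont continuous_at_imp_continuous_on)
  have "continuous_on UNIV (\<lambda>u. m (z u))"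
    by (rule continuous_on_compose2[OF m(1) contz]) (use XY in \<open>auto simp: z_def\<close>)
  hence contl: "continuous_on UNIV l"
    unfolding l_def E_def using m(2)[OF XY] \<open>\<kappa> \<noteq> 0\<close>
    by (auto intro!: continuous_intros contS simp: z_def less_imp_neq[THEN not_sym])
  \<comment> \<open>Opposite signs of the abscissa show that the curve is not constant.\<close>
  have "X pi < 0" "X 0 > 0"
    using R(1) by (simp_all add: X_def C_def)
  hence "z pi \<noteq> z 0" by (simp add: z_def)
  hence "periodic_orbit f g (range z)"
    by (intro periodic_orbit_range_closed_curve[OF contl _ _ perl perz z])
       (use E m(2)[OF XY] \<open>\<kappa> \<noteq> 0\<close> in \<open>auto simp: l_def\<close>)
  moreover have "z0 \<in> range z"
  proof -
    \<comment> \<open>As \<open>\<epsilon>\<close> is its own inverse, solving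
      \<open>D u = y0\<close> for \<open>sin u\<close> gives
      \<open>\<epsilon> * y0 / R\<close>.\<close>
    have "(x0 / R)\<^sup>2 + (\<epsilon> * y0 / R)\<^sup>2 = 1"
      using R(1) \<epsilon>(1) z0(2)
      by (auto simp: power_divide power_mult_distrib power2_eq_square[of \<epsilon>] R(2) sum_power2_eq_zero_iff
          simp flip: add_divide_distrib)
    then obtain u where u: "x0 / R = cos u" "\<epsilon> * y0 / R = sin u"
      using sincos_total_2pi by metis
    have "C u = x0" "D u = y0"
      using R(1) \<epsilon>(1) by (simp_all add: C_def D_def flip: u)
    hence "z u = z0" by (simp add: z_def X_def Y_def S_def z0)
    thus ?thesis by blast
  qed
  moreover have "range z \<subseteq> UNIV - {(0, 0)}"
    using XY by (auto simp: z_def)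
  ultimately show "\<exists>S. periodic_orbit f g S \<and> z0 \<in> S \<and> S \<subseteq> UNIV - {(0, 0)}"
    by blast
qed

section \<open>Weighted scaling of the logarithm\<close>

text \<open>Homogeneity of \<open>h\<close> determines \<open>W\<close> only modulo multiples of
  \<open>2 pi i\<close>. Along the weighted flow, however, \<open>W\<close> minus
  \<open>\<delta> * s\<close> has derivative zero, so it keeps its value at
  \<open>s = 0\<close>.\<close>

lemma complex_log_weight_homogeneous:
  fixes W h :: "real \<times> real \<Rightarrow> complex"
  assumes cont: "continuous_on (UNIV - {(0, 0)}) W"
    and exp: "\<And>z. z \<noteq> (0, 0) \<Longrightarrow> exp (W z) = h z"
    and hom: "\<And>x y s. h (exp (\<alpha> * s) * x, exp (\<beta> * s) * y) = exp (of_real (\<delta> * s)) * h (x, y)"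
    and "(x, y) \<noteq> (0, 0)"
  shows "W (exp (\<alpha> * s) * x, exp (\<beta> * s) * y) = W (x, y) + of_real (\<delta> * s)"
proof -
  define w where "w s = W (exp (\<alpha> * s) * x, exp (\<beta> * s) * y)" for s
  have nz: "(exp (\<alpha> * s) * x, exp (\<beta> * s) * y) \<noteq> (0, 0)" for s
    using assms(4) by auto
  have "continuous_on UNIV w"
    unfolding w_def by (rule continuous_on_compose2[OF cont]) (use nz in \<open>auto intro!: continuous_intros\<close>)
  hence contw: "isCont w s" for s
    by (simp add: continuous_on_eq_continuous_at)
  have expw: "exp (w s) = exp (of_real (\<delta> * s)) * h (x, y)" for s
    unfolding w_def exp[OF nz] hom ..
  have "((\<lambda>s. w s - of_real (\<delta> * s)) has_vector_derivative 0) (at s)" for s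
  proof -
    have "((\<lambda>s. exp (of_real (\<delta> * s) :: complex)) has_vector_derivative
            (of_real \<delta> * exp (of_real (\<delta> * s)))) (at s)"
      unfolding of_real_mult
      by (rule has_vector_derivative_real_field) (auto intro!: derivative_eq_intros)
    hence "((\<lambda>s. exp (of_real (\<delta> * s)) * h (x, y)) has_derivative
        (\<lambda>v. v *\<^sub>R (of_real \<delta> * exp (of_real (\<delta> * s)) * h (x, y)))) (at s)"
      unfolding has_vector_derivative_def[symmetric]
      by (auto intro!: derivative_eq_intros)
    \<comment> \<open>The logarithmic derivative of a constant times
      \<open>exp (\<delta> * s)\<close> is \<open>\<delta>\<close>.\<close>
    from has_derivative_continuous_log[OF contw _ this]
    have "(w has_derivative (\<lambda>v. v *\<^sub>R of_real \<delta>)) (at s)"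
      using exp_not_eq_zero[of "W (x, y)"] by (simp add: expw exp[OF assms(4)] scaleR_conv_of_real)
    hence "(w has_vector_derivative of_real \<delta>) (at s)"
      by (simp add: has_vector_derivative_def)
    moreover have "((\<lambda>s. of_real (\<delta> * s) :: complex) has_vector_derivative of_real \<delta>) (at s)"
      by (intro has_vector_derivative_of_real) (auto intro!: derivative_eq_intros
            simp flip: has_real_derivative_iff_has_vector_derivative)
    ultimately show ?thesis
      using has_vector_derivative_diff by fastforce
  qed
  then obtain c where "\<And>s. s \<in> UNIV \<Longrightarrow> w s - of_real (\<delta> * s) = c"
    by (rule has_vector_derivative_zero_constant[OF convex_UNIV]) (rule that)
  from this[of s] this[of 0] show ?thesis
    by (simp add: w_def algebra_simps)
qed

section \<open>Polynomial form of the field and its global center\<close>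

text \<open>A power times its conjugate is its squared modulus. Taking \<open>s\<close> to be
  \<open>\<sigma>\<close> or \<open>1 - \<sigma>\<close> makes \<open>H\<close> and \<open>V\<close>
  explicit real exponentials.\<close>

lemma cpow_mult_cnj:
  "cpow h \<theta> s x y * cnj (cpow h \<theta> s x y)
     = of_real (exp (2 * Re (s * Complex (ln (cmod (h x y))) (\<theta> (x, y)))))"
  unfolding cpow_def complex_norm_square[symmetric] norm_exp_eq_Re exp_double ..

theorem theorem2:
  fixes \<alpha> \<beta> \<delta> :: real
    and h1 h2 :: "real poly poly"
    and \<sigma> :: complex
    and \<theta> :: "real \<times> real \<Rightarrow> real"
    and H V :: "real \<Rightarrow> real \<Rightarrow> complex"
  assumes "\<alpha> > 0" and "\<beta> > 0"
    and "\<And>\<rho> x y. \<rho> > 0 \<Longrightarrow>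
           eval2 h1 (\<rho> powr \<alpha> * x) (\<rho> powr \<beta> * y) = \<rho> powr \<delta> * eval2 h1 x y"
    and "\<And>\<rho> x y. \<rho> > 0 \<Longrightarrow>
           eval2 h2 (\<rho> powr \<alpha> * x) (\<rho> powr \<beta> * y) = \<rho> powr \<delta> * eval2 h2 x y"
    and "\<And>x y. eval2 h2 x y \<ge> 0"
    and "\<And>x y. eval2 h1 x y = 0 \<and> eval2 h2 x y = 0 \<longleftrightarrow> (x, y) = (0, 0)"
    and "Re \<sigma> \<noteq> 0"
    and "arg_determination (hc h1 h2) \<theta>"
  defines "H \<equiv> Hfun (hc h1 h2) \<theta> \<sigma>"
    and "V \<equiv> Vfun (hc h1 h2) \<theta> \<sigma>"
  shows "(\<forall>x y. (x, y) \<noteq> (0, 0) \<longrightarrow>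
            H x y \<in> \<real> \<and> V x y \<in> \<real> \<and> partials_exist_at H x y) \<and>
         (\<exists>P Q :: real poly poly.
            (\<forall>x y. (x, y) \<noteq> (0, 0) \<longrightarrow>
               of_real (eval2 P x y) = partial_y H x y * V x y \<and>
               of_real (eval2 Q x y) = - partial_x H x y * V x y) \<and>
            weight_homogeneous \<alpha> \<beta> (2 * \<delta> - \<alpha> - \<beta>) (eval2 P) (eval2 Q) \<and>
            global_center (eval2 P) (eval2 Q))"
proof -
  define h where "h z = hc h1 h2 (fst z) (snd z)" for z
  define W where "W z = Complex (ln (cmod (h z))) (\<theta> z)" for z
  define L where "L z = Re (\<sigma> * W z)" for z
  define h1x h1y h2x h2y where partials: "h1x = map_poly pderiv h1" "h1y = pderiv h1"
    "h2x = map_poly pderiv h2" "h2y = pderiv h2"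
  \<comment> \<open>Because \<open>dW = dh / h\<close>, \<open>p\<close> and \<open>q\<close> will
    be the partial derivatives of \<open>L\<close>; \<open>hc h1x h2x\<close> is the
    \<open>x\<close> derivative of \<open>h\<close>.\<close>
  define p where "p x y = Re (\<sigma> * (hc h1x h2x x y / h (x, y)))" for x y
  define q where "q x y = Re (\<sigma> * (hc h1y h2y x y / h (x, y)))" for x y
  have h0: "h z = 0 \<longleftrightarrow> z = (0, 0)" for z
    using assms(6)[of "fst z" "snd z"] by (auto simp: h_def hc_def complex_eq_iff)
  have conth: "continuous_on A h" for A
    unfolding h_def hc_def Complex_eq by (intro continuous_intros continuous_on_eval2)
  have expW: "exp (W z) = h z" if "z \<noteq> (0, 0)" for z
  proof -
    have "exp (W z) = of_real (cmod (h z)) * cis (\<theta> z)"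
      using h0[of z] that by (simp add: exp_eq_polar W_def flip: exp_of_real)
    also have "\<dots> = h z"
      using assms(8) that by (cases z) (simp add: arg_determination_def h_def)
    finally show ?thesis .
  qed
  have contW: "continuous_on (UNIV - {(0, 0)}) W"
    using assms(8) h0 unfolding W_def Complex_eq arg_determination_def
    by (intro continuous_intros conth) auto
  have WD: "(W has_derivative (\<lambda>v. (hc h1x h2x x y * of_real (fst v) + hc h1y h2y x y * of_real (snd v)) / h (x, y)))
      (at (x, y))" if "(x, y) \<noteq> (0, 0)" for x y
  proof (rule has_derivative_continuous_log)
    have opn: "open (UNIV - {(0::real, 0::real)})" by (simp add: open_delete)
    show "isCont W (x, y)"
      using contW that opn by (simp add: continuous_on_eq_continuous_at)
    show "eventually (\<lambda>z. exp (W z) = h z) (nhds (x, y))"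
      using eventually_nhds_in_open[OF opn, of "(x, y)"] that expW
      by (auto elim!: eventually_mono)
    have "(h has_derivative (\<lambda>v. of_real (eval2 h1x x y * fst v + eval2 h1y x y * snd v)
        + \<i> * of_real (eval2 h2x x y * fst v + eval2 h2y x y * snd v))) (at (x, y))"
      unfolding h_def hc_def Complex_eq partials
      by (intro has_derivative_add has_derivative_mult_right has_derivative_of_real has_derivative_eval2)
    thus "(h has_derivative (\<lambda>v. hc h1x h2x x y * of_real (fst v) + hc h1y h2y x y * of_real (snd v))) (at (x, y))"
      by (rule has_derivative_eq_rhs) (auto simp: hc_def complex_eq_iff)
  qed
  have re: "Re (of_real r * u) = r * Re u" for r u by simp
  have LD: "(L has_derivative (\<lambda>v. p x y * fst v + q x y * snd v)) (at (x, y))"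
    if "(x, y) \<noteq> (0, 0)" for x y
  proof -
    have "(L has_derivative (\<lambda>v. Re (\<sigma> * ((hc h1x h2x x y * of_real (fst v) + hc h1y h2y x y * of_real (snd v)) / h (x, y)))))
        (at (x, y))"
      unfolding L_def by (intro has_derivative_Re has_derivative_mult_right WD that)
    moreover have "Re (\<sigma> * ((a * of_real r + b * of_real s) / w)) = Re (\<sigma> * (a / w)) * r + Re (\<sigma> * (b / w)) * s"
      for a b w r s
    proof -
      have eq: "\<sigma> * ((a * of_real r + b * of_real s) / w) = of_real r * (\<sigma> * (a / w)) + of_real s * (\<sigma> * (b / w))"
        by (simp add: add_divide_distrib algebra_simps)
      show ?thesis unfolding eq plus_complex.sel re by (simp only: mult.commute)
    qed
    ultimately show ?thesis
      by (simp only: p_def q_def)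
  qed
  \<comment> \<open>This holds at the origin too, both sides containing the same
    \<open>ln 0\<close>, so \<open>H\<close> can be rewritten under a function of one variable whose
    line passes through the origin.\<close>
  have H: "H x y = of_real (exp (2 * L (x, y)))" for x y
    by (simp add: H_def Hfun_def cpow_mult_cnj L_def W_def h_def del: times_complex.sel)
  have V: "V x y = of_real (exp (2 * Re ((1 - \<sigma>) * W (x, y))) / 2)" for x y
    by (simp add: V_def Vfun_def cpow_mult_cnj W_def h_def del: times_complex.sel)
  \<comment> \<open>The exponents \<open>\<sigma>\<close> and \<open>1 - \<sigma>\<close> add up to
    1, so \<open>\<sigma>\<close> cancels.\<close>
  have HV: "exp (2 * L (x, y)) * exp (2 * Re ((1 - \<sigma>) * W (x, y))) = (cmod (h (x, y)))\<^sup>2"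
    if "(x, y) \<noteq> (0, 0)" for x y
  proof -
    have "2 * L (x, y) + 2 * Re ((1 - \<sigma>) * W (x, y)) = 2 * Re (W (x, y))"
      by (simp add: L_def algebra_simps)
    thus ?thesis
      unfolding exp_add[symmetric] by (simp add: exp_double flip: expW[OF that])
  qed
  have Hx: "((\<lambda>s. H s y) has_vector_derivative of_real (exp (2 * L (x, y)) * (2 * p x y))) (at x)"
    and Hy: "((\<lambda>s. H x s) has_vector_derivative of_real (exp (2 * L (x, y)) * (2 * q x y))) (at y)"
    if "(x, y) \<noteq> (0, 0)" for x y
  proof -
    have "((\<lambda>s. L (s, y)) has_real_derivative p x y) (at x)"
      using has_derivative_pair_curve[where x="\<lambda>s. s" and y="\<lambda>_. y" and t=x and x'=1 and y'=0,
          OF LD[OF that]]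
      by (simp add: has_real_derivative_iff_has_vector_derivative)
    thus "((\<lambda>s. H s y) has_vector_derivative of_real (exp (2 * L (x, y)) * (2 * p x y))) (at x)"
      unfolding H by (intro has_vector_derivative_of_real) (auto intro!: derivative_eq_intros
          simp flip: has_real_derivative_iff_has_vector_derivative)
    have "((\<lambda>s. L (x, s)) has_real_derivative q x y) (at y)"
      using has_derivative_pair_curve[where x="\<lambda>_. x" and y="\<lambda>s. s" and t=y and x'=0 and y'=1,
          OF LD[OF that]]
      by (simp add: has_real_derivative_iff_has_vector_derivative)
    thus "((\<lambda>s. H x s) has_vector_derivative of_real (exp (2 * L (x, y)) * (2 * q x y))) (at y)"
      unfolding H by (intro has_vector_derivative_of_real) (auto intro!: derivative_eq_intros
          simp flip: has_real_derivative_iff_has_vector_derivative)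
  qed
  \<comment> \<open>The 2 from differentiating \<open>exp (2 * L)\<close> cancels the
    \<open>1 / 2\<close> in \<open>V\<close>.\<close>
  have hV: "of_real (exp (2 * L (x, y)) * (2 * r)) * V x y = of_real ((cmod (h (x, y)))\<^sup>2 * r)"
    if "(x, y) \<noteq> (0, 0)" for x y r
    unfolding V of_real_mult[symmetric] HV[OF that, symmetric] by simp
  \<comment> \<open>These expand \<open>Re (\<sigma> h_y cnj h)\<close> and
    \<open>- Re (\<sigma> h_x cnj h)\<close> into real and imaginary parts.\<close>
  define P where "P = smult [:Re \<sigma>:] (h1 * h1y + h2 * h2y) - smult [:Im \<sigma>:] (h1 * h2y - h2 * h1y)"
  define Q where "Q = smult [:Im \<sigma>:] (h1 * h2x - h2 * h1x) - smult [:Re \<sigma>:] (h1 * h1x + h2 * h2x)"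
  \<comment> \<open>Since the squared modulus is \<open>w * cnj w\<close>, it clears the denominator
    \<open>h\<close> and leaves a polynomial expression.\<close>
  have mult_div: "(cmod w)\<^sup>2 * Re (s * (v / w)) = Re (s * v * cnj w)" if "w \<noteq> 0" for s v w
  proof -
    have "(cmod w)\<^sup>2 * Re (s * (v / w)) = Re (of_real ((cmod w)\<^sup>2) * (s * (v / w)))" by (rule re[symmetric])
    also have "of_real ((cmod w)\<^sup>2) * (s * (v / w)) = s * v * cnj w"
      unfolding complex_norm_square using that by simp
    finally show ?thesis .
  qed
  have P: "eval2 P x y = (cmod (h (x, y)))\<^sup>2 * q x y"
    and Q: "eval2 Q x y = - ((cmod (h (x, y)))\<^sup>2 * p x y)" if "(x, y) \<noteq> (0, 0)" for x y
  proof -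
    have nz: "h (x, y) \<noteq> 0" using h0 that by blast
    show "eval2 P x y = (cmod (h (x, y)))\<^sup>2 * q x y"
      "eval2 Q x y = - ((cmod (h (x, y)))\<^sup>2 * p x y)"
      unfolding p_def q_def mult_div[OF nz]
      by (simp_all add: P_def Q_def h_def hc_def algebra_simps)
  qed
  have "of_real (eval2 P x y) = partial_y H x y * V x y \<and> of_real (eval2 Q x y) = - partial_x H x y * V x y"
    if "(x, y) \<noteq> (0, 0)" for x y
    unfolding partial_x_def partial_y_def vector_derivative_at[OF Hx[OF that]]
      vector_derivative_at[OF Hy[OF that]] P[OF that] Q[OF that] mult_minus_left hV[OF that]
    by simp
  moreover have "H x y \<in> \<real> \<and> V x y \<in> \<real> \<and> partials_exist_at H x y" if "(x, y) \<noteq> (0, 0)" for x y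
    using differentiableI_vector[OF Hx[OF that]] differentiableI_vector[OF Hy[OF that]]
    by (simp add: partials_exist_at_def) (simp add: H V)
  moreover have "weight_homogeneous \<alpha> \<beta> (2 * \<delta> - \<alpha> - \<beta>) (eval2 P) (eval2 Q)"
    unfolding weight_homogeneous_def
  proof (intro conjI allI impI assms(1,2))
    fix \<rho> x y :: real
    assume \<rho>: "\<rho> > 0"
    note hom = assms(3,4)[OF \<rho>]
    note homx = eval2_partials_homogeneous(1)[OF hom(1)] eval2_partials_homogeneous(1)[OF hom(2)]
    note homy = eval2_partials_homogeneous(2)[OF hom(1)] eval2_partials_homogeneous(2)[OF hom(2)]
    \<comment> \<open>Each term of \<open>P\<close> pairs some \<open>h_i\<close>, which scales by
      \<open>\<rho> powr \<delta>\<close>, with a \<open>y\<close> derivative, which does so after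
      multiplication by \<open>\<rho> powr \<beta>\<close>. The division comes at the end.\<close>
    have "\<rho> powr \<beta> * eval2 P (\<rho> powr \<alpha> * x) (\<rho> powr \<beta> * y) = \<rho> powr \<delta> * \<rho> powr \<delta> * eval2 P x y"
      using homy[of x y] unfolding P_def partials by (simp add: hom) algebra
    moreover have "\<rho> powr \<alpha> * eval2 Q (\<rho> powr \<alpha> * x) (\<rho> powr \<beta> * y) = \<rho> powr \<delta> * \<rho> powr \<delta> * eval2 Q x y"
      using homx[of x y] unfolding Q_def partials by (simp add: hom) algebra
    moreover have "2 * \<delta> - \<alpha> - \<beta> + \<alpha> = \<delta> + \<delta> - \<beta>" "2 * \<delta> - \<alpha> - \<beta> + \<beta> = \<delta> + \<delta> - \<alpha>"
      by simp_all
    ultimately show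
      "eval2 P (\<rho> powr \<alpha> * x) (\<rho> powr \<beta> * y) = \<rho> powr (2 * \<delta> - \<alpha> - \<beta> + \<alpha>) * eval2 P x y"
      "eval2 Q (\<rho> powr \<alpha> * x) (\<rho> powr \<beta> * y) = \<rho> powr (2 * \<delta> - \<alpha> - \<beta> + \<beta>) * eval2 Q x y"
      using \<rho> by (simp_all only: powr_diff powr_add) (simp_all add: field_simps)
  qed
  moreover have "global_center (eval2 P) (eval2 Q)"
  proof -
    have homh: "h (exp (\<alpha> * s) * x, exp (\<beta> * s) * y) = exp (of_real (\<delta> * s)) * h (x, y)" for x y s
      using assms(3,4)[of "exp s" x y]
      by (simp add: h_def hc_def complex_eq_iff powr_def exp_of_real del: of_real_mult)
    \<comment> \<open>Were \<open>\<delta>\<close> zero, \<open>h\<close> would be constant on the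
      positive \<open>x\<close> axis, and continuity would force
      \<open>h (1, 0) = h (0, 0) = 0\<close>.\<close>
    have "\<delta> \<noteq> 0"
    proof
      assume "\<delta> = 0"
      have "h (t, 0) = h (1, 0)" if "t > 0" for t
        using homh[of "ln t / \<alpha>" 1 0] that \<open>\<alpha> > 0\<close> \<open>\<delta> = 0\<close> by simp
      hence "eventually (\<lambda>t. h (t, 0) = h (1, 0)) (at_right 0)"
        by (rule eventually_mono[OF eventually_at_right_less])
      moreover have "continuous_on UNIV (\<lambda>t. h (t, 0))"
        by (rule continuous_on_compose2[OF conth]) (auto intro!: continuous_intros)
      hence "((\<lambda>t. h (t, 0)) \<longlongrightarrow> h (0, 0)) (at_right 0)"
        unfolding continuous_on_def by (blast intro: tendsto_mono[OF at_le[OF subset_UNIV]])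
      ultimately have "((\<lambda>_. h (1, 0)) \<longlongrightarrow> h (0, 0)) (at_right (0::real))"
        by (rule Lim_transform_eventually[rotated])
      hence "h (1, 0) = h (0, 0)" by (simp add: tendsto_const_iff)
      thus False using h0[of "(1, 0)"] h0[of "(0, 0)"] by simp
    qed
    have "union_of_periodic_orbits (eval2 P) (eval2 Q) (UNIV - {(0, 0)})"
    proof (rule weighted_polar_union_of_periodic_orbits[OF assms(1,2) _ LD _ _ _ P Q])
      \<comment> \<open>The slope \<open>\<kappa>\<close> is \<open>Re \<sigma> * \<delta>\<close>,
        because the flow adds the real number \<open>\<delta> * s\<close> to
        \<open>W\<close>.\<close>
      show "Re \<sigma> * \<delta> \<noteq> 0" using assms(7) \<open>\<delta> \<noteq> 0\<close> by simp
      show "L (exp (\<alpha> * s) * x, exp (\<beta> * s) * y) = L (x, y) + Re \<sigma> * \<delta> * s"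
        if "(x, y) \<noteq> (0, 0)" for x y s
        using complex_log_weight_homogeneous[OF contW expW homh that, of s]
        by (simp add: L_def distrib_left)
      show "continuous_on (UNIV - {(0, 0)}) (\<lambda>z. (cmod (h z))\<^sup>2)"
        by (intro continuous_intros conth)
      show "(cmod (h z))\<^sup>2 > 0" if "z \<noteq> (0, 0)" for z
        using h0[of z] that by simp
    qed
    \<comment> \<open>Every term of \<open>P\<close> and \<open>Q\<close> has a factor
      \<open>h1\<close> or \<open>h2\<close>, so the origin is an equilibrium.\<close>
    moreover have "eval2 h1 0 0 = 0" "eval2 h2 0 0 = 0" using assms(6)[of 0 0] by auto
    hence "eval2 P 0 0 = 0" "eval2 Q 0 0 = 0" by (simp_all add: P_def Q_def)
    ultimately show ?thesis
      unfolding global_center_def center_at_origin_def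
      by (auto intro!: exI[of _ UNIV])
  qed
  ultimately show ?thesis by blast
qed

end
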